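(* Let $n\ge 2$. Then, for every $k\in\{1,\dots,n-1\}$ such that $\gcd(n,k)=1$, the virtually cyclic group $\mathbb{Z}_n\rtimes_{\alpha_k}\mathbb{Z}$ can be realized in $VB_n/\Gamma_2(VP_n)$, i.e. $VB_n/\Gamma_2(VP_n)$ has a subgroup isomorphic to $\mathbb{Z}_n\rtimes_{\alpha_k}\mathbb{Z}$.
   Context: $\mathbb{Z}_n$ is the cyclic group of order $n$; for $\gcd(n,k)=1$, $\alpha_k\colon\mathbb{Z}_n\to\mathbb{Z}_n$ is the automorphism $\delta\mapsto k\delta$, and in $\mathbb{Z}_n\rtimes_{\alpha_k}\mathbb{Z}$ a generator of $\mathbb{Z}$ acts on $\mathbb{Z}_n$ by $\alpha_k$. A group is virtually cyclic if it has a cyclic subgroup of finite index. $\Gamma_2(H)=[H,H]$. $VB_n$ is the group with generators $\sigma_i,\rho_i$ ($1\le i\le n-1$) and relations: $\sigma_i\sigma_{i+1}\sigma_i=\sigma_{i+1}\sigma_i\sigma_{i+1}$, $\rho_i\rho_{i+1}\rho_i=\rho_{i+1}\rho_i\rho_{i+1}$, $\rho_i\rho_{i+1}\sigma_i=\sigma_{i+1}\rho_i\rho_{i+1}$ for $1\le i\le n-2$; $\rho_i^2=1$; and $\sigma_i\sigma_j=\sigma_j\sigma_i$, $\rho_i\rho_j=\rho_j\rho_i$, $\sigma_i\rho_j=\rho_j\sigma_i$ for $|i-j|\ge 2$. $VP_n$ is the kernel of the homomorphism $VB_n\to S_n$, $\sigma_i,\rho_i\mapsto(i,i+1)$. *)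

theory Defs
  imports
    "HOL-Algebra.Bij"
    "HOL-Algebra.Elementary_Groups"
    "HOL-Algebra.Sym_Groups"
begin

section \<open>Groups given by generators and relations\<close>

text \<open>
  The letter \<open>(x, True)\<close> stands for the generator \<open>x\<close> and \<open>(x, False)\<close> for its formal inverse.
  A relation \<open>(l, r)\<close> is read as the equation \<open>l = r\<close>.
\<close>

type_synonym 'a word = "('a \<times> bool) list"

definition words :: "'a set \<Rightarrow> 'a word set"
  where "words S = lists (S \<times> UNIV)"

inductive_set pres_rel :: "'a set \<Rightarrow> ('a word \<times> 'a word) set \<Rightarrow> ('a word \<times> 'a word) set"
  for S R where
    refl: "w \<in> words S \<Longrightarrow> (w, w) \<in> pres_rel S R"
  | sym: "(v, w) \<in> pres_rel S R \<Longrightarrow> (w, v) \<in> pres_rel S R"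
  | trans: "(u, v) \<in> pres_rel S R \<Longrightarrow> (v, w) \<in> pres_rel S R \<Longrightarrow> (u, w) \<in> pres_rel S R"
  | cancel: "u \<in> words S \<Longrightarrow> v \<in> words S \<Longrightarrow> x \<in> S \<Longrightarrow>
      (u @ [(x, b), (x, \<not> b)] @ v, u @ v) \<in> pres_rel S R"
  | rel: "(l, r) \<in> R \<Longrightarrow> u @ l @ v \<in> words S \<Longrightarrow> u @ r @ v \<in> words S \<Longrightarrow>
      (u @ l @ v, u @ r @ v) \<in> pres_rel S R"

definition presented_group :: "'a set \<Rightarrow> ('a word \<times> 'a word) set \<Rightarrow> 'a word set monoid"
  where "presented_group S R =
    \<lparr>carrier = words S // pres_rel S R,
     monoid.mult = (\<lambda>A B. \<Union>a\<in>A. \<Union>b\<in>B. pres_rel S R `` {a @ b}),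
     one = pres_rel S R `` {[]}\<rparr>"

definition pres_gen :: "'a set \<Rightarrow> ('a word \<times> 'a word) set \<Rightarrow> 'a \<Rightarrow> 'a word set"
  where "pres_gen S R x = pres_rel S R `` {[(x, True)]}"

fun word_eval :: "('b, 'c) monoid_scheme \<Rightarrow> ('a \<Rightarrow> 'b) \<Rightarrow> 'a word \<Rightarrow> 'b"
  where
    "word_eval G f [] = \<one>\<^bsub>G\<^esub>"
  | "word_eval G f ((x, b) # w) = (if b then f x else inv\<^bsub>G\<^esub> f x) \<otimes>\<^bsub>G\<^esub> word_eval G f w"

text \<open>
  The homomorphism out of a presented group determined by the images of the generators; see
  \<open>pres_lift_hom\<close> and \<open>pres_lift_gen\<close> below.
\<close>

definition pres_lift :: "('b, 'c) monoid_scheme \<Rightarrow> ('a \<Rightarrow> 'b) \<Rightarrow> 'a word set \<Rightarrow> 'b"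
  where "pres_lift G f A = the_elem (word_eval G f ` A)"

lemma words_Nil [simp]: "[] \<in> words S"
  by (simp add: words_def)

lemma words_Cons [simp]: "(x, b) # w \<in> words S \<longleftrightarrow> x \<in> S \<and> w \<in> words S"
  by (simp add: words_def)

lemma words_append [simp]: "v @ w \<in> words S \<longleftrightarrow> v \<in> words S \<and> w \<in> words S"
  by (auto simp: words_def)

lemma pres_rel_words: "(v, w) \<in> pres_rel S R \<Longrightarrow> v \<in> words S \<and> w \<in> words S"
  by (induction rule: pres_rel.induct) auto

lemma equiv_pres_rel: "equiv (words S) (pres_rel S R)"
proof (rule equivI)
  show "pres_rel S R \<subseteq> words S \<times> words S"
    using pres_rel_words by fastforce
  show "refl_on (words S) (pres_rel S R)"
    by (auto simp: refl_on_def intro: pres_rel.refl)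
  show "sym (pres_rel S R)"
    by (auto simp: sym_def intro: pres_rel.sym)
  show "trans (pres_rel S R)"
    by (auto simp: trans_def intro: pres_rel.trans)
qed

lemma pres_rel_context:
  assumes "(a, b) \<in> pres_rel S R" "u \<in> words S" "v \<in> words S"
  shows "(u @ a @ v, u @ b @ v) \<in> pres_rel S R"
  using assms
proof (induction rule: pres_rel.induct)
  case (cancel u' v' x b)
  then show ?case using pres_rel.cancel[of "u @ u'" S "v' @ v" x b R] by simp
next
  case (rel l r u' v')
  then show ?case using pres_rel.rel[of l r R "u @ u'" "v' @ v" S] by simp
qed (auto intro: pres_rel.refl pres_rel.sym pres_rel.trans)

lemma pres_rel_append:
  assumes "(a, a') \<in> pres_rel S R" "(b, b') \<in> pres_rel S R"
  shows "(a @ b, a' @ b') \<in> pres_rel S R"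
proof -
  have "(a @ b, a' @ b) \<in> pres_rel S R"
    using pres_rel_context[OF assms(1), of "[]" b] pres_rel_words[OF assms(2)] by simp
  moreover have "(a' @ b, a' @ b') \<in> pres_rel S R"
    using pres_rel_context[OF assms(2), of a' "[]"] pres_rel_words[OF assms(1)] by simp
  ultimately show ?thesis by (rule pres_rel.trans)
qed

lemma presented_group_mult:
  assumes "a \<in> words S" "b \<in> words S"
  shows "pres_rel S R `` {a} \<otimes>\<^bsub>presented_group S R\<^esub> pres_rel S R `` {b}
       = pres_rel S R `` {a @ b}"
proof -
  have "pres_rel S R `` {a' @ b'} = pres_rel S R `` {a @ b}"
    if "(a, a') \<in> pres_rel S R" "(b, b') \<in> pres_rel S R" for a' b'
    using equiv_class_eq[OF equiv_pres_rel pres_rel_append[OF that]] by simp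
  then show ?thesis
    using assms by (auto simp: presented_group_def intro: pres_rel.refl)
qed

lemma presented_group_carrier:
  "carrier (presented_group S R) = (\<lambda>w. pres_rel S R `` {w}) ` words S"
  by (auto simp: presented_group_def quotient_def)

lemma pres_rel_inverse:
  "w \<in> words S \<Longrightarrow> (map (\<lambda>(x, b). (x, \<not> b)) (rev w) @ w, []) \<in> pres_rel S R
    \<and> map (\<lambda>(x, b). (x, \<not> b)) (rev w) \<in> words S"
proof (induction w)
  case Nil
  then show ?case by (auto intro: pres_rel.refl)
next
  case (Cons p w)
  obtain x b where p: "p = (x, b)" by (cases p)
  let ?u = "map (\<lambda>(x, b). (x, \<not> b)) (rev w)"
  have "(?u @ [(x, \<not> b), (x, \<not> \<not> b)] @ w, ?u @ w) \<in> pres_rel S R"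
    using Cons p by (intro pres_rel.cancel) auto
  then show ?case
    using Cons p by (auto intro: pres_rel.trans)
qed

lemma group_presented_group: "group (presented_group S R)"
proof (rule groupI)
  fix X Y Z
  assume "X \<in> carrier (presented_group S R)" "Y \<in> carrier (presented_group S R)"
    and "Z \<in> carrier (presented_group S R)"
  then show "X \<otimes>\<^bsub>presented_group S R\<^esub> Y \<otimes>\<^bsub>presented_group S R\<^esub> Z
    = X \<otimes>\<^bsub>presented_group S R\<^esub> (Y \<otimes>\<^bsub>presented_group S R\<^esub> Z)"
    by (auto simp: presented_group_carrier presented_group_mult)
next
  fix X
  assume "X \<in> carrier (presented_group S R)"
  then obtain w where w: "w \<in> words S" "X = pres_rel S R `` {w}"
    by (auto simp: presented_group_carrier)
  let ?u = "map (\<lambda>(x, b). (x, \<not> b)) (rev w)"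
  have "pres_rel S R `` {?u} \<otimes>\<^bsub>presented_group S R\<^esub> X = pres_rel S R `` {[]}"
    using w pres_rel_inverse[of w S R]
      equiv_class_eq[OF equiv_pres_rel, of "?u @ w" "[]" S R]
    by (simp add: presented_group_mult)
  then show "\<exists>Y \<in> carrier (presented_group S R).
      Y \<otimes>\<^bsub>presented_group S R\<^esub> X = \<one>\<^bsub>presented_group S R\<^esub>"
    using pres_rel_inverse[of w S R] w
    by (intro bexI[of _ "pres_rel S R `` {?u}"])
      (simp_all add: presented_group_def quotientI)
next
  fix X
  assume "X \<in> carrier (presented_group S R)"
  then show "\<one>\<^bsub>presented_group S R\<^esub> \<otimes>\<^bsub>presented_group S R\<^esub> X = X"
    using presented_group_mult[of "[]" S _ R]
    by (auto simp: presented_group_carrier) (auto simp: presented_group_def)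
qed (auto simp: presented_group_carrier presented_group_mult,
     auto simp: presented_group_def)

context group
begin

lemma word_eval_closed:
  "f \<in> S \<rightarrow> carrier G \<Longrightarrow> w \<in> words S \<Longrightarrow> word_eval G f w \<in> carrier G"
  by (induction w) (auto dest: funcset_mem)

lemma word_eval_append:
  assumes "f \<in> S \<rightarrow> carrier G" "v \<in> words S" "w \<in> words S"
  shows "word_eval G f (v @ w) = word_eval G f v \<otimes> word_eval G f w"
  using assms(2)
proof (induction v)
  case Nil
  then show ?case using word_eval_closed[OF assms(1,3)] by simp
next
  case (Cons p v)
  then show ?case
    using assms(1) word_eval_closed[OF assms(1)] assms(3) by (cases p) (auto simp: m_assoc dest: funcset_mem)
qed

lemma word_eval_pres_rel:
  assumes f: "f \<in> S \<rightarrow> carrier G"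
    and R: "\<And>l r. (l, r) \<in> R \<Longrightarrow> word_eval G f l = word_eval G f r"
    and "(v, w) \<in> pres_rel S R"
  shows "word_eval G f v = word_eval G f w"
  using assms(3)
proof (induction rule: pres_rel.induct)
  case (cancel u v x b)
  then have "f x \<in> carrier G" using f by auto
  then have "word_eval G f ([(x, b), (x, \<not> b)] @ v) = word_eval G f v"
    using word_eval_closed[OF f \<open>v \<in> words S\<close>] by (auto simp: m_assoc[symmetric])
  with cancel show ?case
    using word_eval_append[OF f, of u v] word_eval_append[OF f, of u "[(x, b), (x, \<not> b)] @ v"]
    by simp
next
  case (rel l r u v)
  then show ?case by (auto simp: word_eval_append[OF f] R)
qed auto

lemma pres_lift_class:
  assumes "f \<in> S \<rightarrow> carrier G"
    and "\<And>l r. (l, r) \<in> R \<Longrightarrow> word_eval G f l = word_eval G f r"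
    and "w \<in> words S"
  shows "pres_lift G f (pres_rel S R `` {w}) = word_eval G f w"
proof -
  have "word_eval G f ` (pres_rel S R `` {w}) = {word_eval G f w}"
    using word_eval_pres_rel[OF assms(1,2)] pres_rel.refl[OF assms(3)] by fastforce
  then show ?thesis by (simp add: pres_lift_def)
qed

lemma pres_lift_hom:
  assumes f: "f \<in> S \<rightarrow> carrier G"
    and R: "\<And>l r. (l, r) \<in> R \<Longrightarrow> word_eval G f l = word_eval G f r"
  shows "pres_lift G f \<in> hom (presented_group S R) G"
  by (rule homI)
    (auto simp: presented_group_carrier presented_group_mult pres_lift_class[OF f R]
      word_eval_append[OF f] word_eval_closed[OF f])

lemma pres_lift_gen:
  assumes f: "f \<in> S \<rightarrow> carrier G"
    and R: "\<And>l r. (l, r) \<in> R \<Longrightarrow> word_eval G f l = word_eval G f r"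
    and x: "x \<in> S"
  shows "pres_lift G f (pres_gen S R x) = f x"
proof -
  have "f x \<in> carrier G" using f x by auto
  then show ?thesis using x by (simp add: pres_gen_def pres_lift_class[OF f R])
qed

end


section \<open>Virtual braid groups\<close>

datatype vb_gen = Sig nat | Rho nat

abbreviation sig_w :: "nat \<Rightarrow> vb_gen word" where "sig_w i \<equiv> [(Sig i, True)]"
abbreviation rho_w :: "nat \<Rightarrow> vb_gen word" where "rho_w i \<equiv> [(Rho i, True)]"

definition vb_gens :: "nat \<Rightarrow> vb_gen set"
  where "vb_gens n = Sig ` {1..n - 1} \<union> Rho ` {1..n - 1}"

definition vb_rels :: "nat \<Rightarrow> (vb_gen word \<times> vb_gen word) set"
  where "vb_rels n =
      {(sig_w i @ sig_w (i + 1) @ sig_w i, sig_w (i + 1) @ sig_w i @ sig_w (i + 1)) | i.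
         i \<in> {1..n - 2}}
    \<union> {(rho_w i @ rho_w (i + 1) @ rho_w i, rho_w (i + 1) @ rho_w i @ rho_w (i + 1)) | i.
         i \<in> {1..n - 2}}
    \<union> {(rho_w i @ rho_w (i + 1) @ sig_w i, sig_w (i + 1) @ rho_w i @ rho_w (i + 1)) | i.
         i \<in> {1..n - 2}}
    \<union> {(rho_w i @ rho_w i, []) | i. i \<in> {1..n - 1}}
    \<union> {(sig_w i @ sig_w j, sig_w j @ sig_w i) | i j.
         i \<in> {1..n - 1} \<and> j \<in> {1..n - 1} \<and> \<bar>int i - int j\<bar> \<ge> 2}
    \<union> {(rho_w i @ rho_w j, rho_w j @ rho_w i) | i j.
         i \<in> {1..n - 1} \<and> j \<in> {1..n - 1} \<and> \<bar>int i - int j\<bar> \<ge> 2}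
    \<union> {(sig_w i @ rho_w j, rho_w j @ sig_w i) | i j.
         i \<in> {1..n - 1} \<and> j \<in> {1..n - 1} \<and> \<bar>int i - int j\<bar> \<ge> 2}"

definition VB :: "nat \<Rightarrow> vb_gen word set monoid"
  where "VB n = presented_group (vb_gens n) (vb_rels n)"

fun vb_perm :: "vb_gen \<Rightarrow> nat \<Rightarrow> nat"
  where
    "vb_perm (Sig i) = transpose i (i + 1)"
  | "vb_perm (Rho i) = transpose i (i + 1)"

definition VB_proj :: "nat \<Rightarrow> vb_gen word set \<Rightarrow> nat \<Rightarrow> nat"
  where "VB_proj n = pres_lift (sym_group n) vb_perm"

definition VP :: "nat \<Rightarrow> vb_gen word set set"
  where "VP n = kernel (VB n) (sym_group n) (VB_proj n)"

lemma vb_perm_closed: "vb_perm \<in> vb_gens n \<rightarrow> carrier (sym_group n)"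
  by (auto simp: vb_gens_def sym_group_carrier intro!: permutes_swap_id)

lemma vb_perm_rels:
  "(l, r) \<in> vb_rels n \<Longrightarrow> word_eval (sym_group n) vb_perm l = word_eval (sym_group n) vb_perm r"
  by (auto simp: vb_rels_def sym_group_mult sym_group_one fun_eq_iff transpose_def)

lemma group_VB: "group (VB n)"
  by (simp add: VB_def group_presented_group)

lemma VB_proj_hom: "VB_proj n \<in> hom (VB n) (sym_group n)"
  unfolding VB_def VB_proj_def
  using group.pres_lift_hom[OF sym_group_is_group vb_perm_closed vb_perm_rels] .

lemma VB_proj_gen:
  assumes "i \<in> {1..n - 1}"
  shows "VB_proj n (pres_gen (vb_gens n) (vb_rels n) (Sig i)) = transpose i (i + 1)"
    and "VB_proj n (pres_gen (vb_gens n) (vb_rels n) (Rho i)) = transpose i (i + 1)"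
  using assms group.pres_lift_gen[OF sym_group_is_group vb_perm_closed vb_perm_rels]
  by (simp_all add: VB_proj_def vb_gens_def)

lemma VP_normal: "VP n \<lhd> VB n"
  unfolding VP_def
  by (intro group_hom.normal_kernel group_hom.intro group_hom_axioms.intro
      group_VB sym_group_is_group VB_proj_hom)

lemma derived_VP_normal: "derived (VB n) (VP n) \<lhd> VB n"
  using group.derived_is_normal[OF group_VB VP_normal] .


section \<open>Semidirect products and virtually cyclic groups\<close>

definition semidirect_product ::
    "('a, 'c) monoid_scheme \<Rightarrow> ('b, 'd) monoid_scheme \<Rightarrow> ('b \<Rightarrow> 'a \<Rightarrow> 'a) \<Rightarrow> ('a \<times> 'b) monoid"
  where "semidirect_product N H \<phi> =
    \<lparr>carrier = carrier N \<times> carrier H,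
     monoid.mult = (\<lambda>(a, g) (b, h). (a \<otimes>\<^bsub>N\<^esub> \<phi> g b, g \<otimes>\<^bsub>H\<^esub> h)),
     one = (\<one>\<^bsub>N\<^esub>, \<one>\<^bsub>H\<^esub>)\<rparr>"

text \<open>Restricted to the carrier because the elements of \<^const>\<open>AutoGroup\<close> are extensional.\<close>

definition mult_aut :: "nat \<Rightarrow> nat \<Rightarrow> int \<Rightarrow> int"
  where "mult_aut n k = (\<lambda>x \<in> carrier (integer_mod_group n). (int k * x) mod int n)"

definition Zn_semidirect_Z :: "nat \<Rightarrow> nat \<Rightarrow> (int \<times> int) monoid"
  where "Zn_semidirect_Z n k =
    semidirect_product (integer_mod_group n) integer_group
      (\<lambda>m :: int. mult_aut n k [^]\<^bsub>AutoGroup (integer_mod_group n)\<^esub> m)"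

definition virtually_cyclic :: "('a, 'b) monoid_scheme \<Rightarrow> bool"
  where "virtually_cyclic G \<longleftrightarrow>
    group G \<and>
    (\<exists>C. subgroup C G \<and> cyclic_group (G\<lparr>carrier := C\<rparr>) \<and> finite (rcosets\<^bsub>G\<^esub> C))"

lemma mult_aut_in_AutoGroup:
  assumes "n \<ge> 1" "gcd n k = 1"
  shows "mult_aut n k \<in> carrier (AutoGroup (integer_mod_group n))"
proof -
  let ?Z = "integer_mod_group n"
  have c: "carrier ?Z = {0..<int n}"
    using assms by (simp add: carrier_integer_mod_group)
  have into: "mult_aut n k \<in> carrier ?Z \<rightarrow> carrier ?Z"
    using assms by (auto simp: mult_aut_def c)
  have "inj_on (mult_aut n k) (carrier ?Z)"
  proof (rule inj_onI)
    fix x y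
    assume xy: "x \<in> carrier ?Z" "y \<in> carrier ?Z" and "mult_aut n k x = mult_aut n k y"
    then have "int n dvd int k * (x - y)"
      by (simp add: mult_aut_def mod_eq_dvd_iff right_diff_distrib)
    moreover have "coprime (int n) (int k)"
      using assms(2) by (simp add: coprime_iff_gcd_eq_1)
    ultimately have "int n dvd x - y"
      by (simp add: coprime_dvd_mult_right_iff)
    then have "x mod int n = y mod int n"
      by (simp add: mod_eq_dvd_iff)
    then show "x = y"
      using xy by (simp add: c)
  qed
  moreover have "finite (carrier ?Z)" by (simp add: c)
  ultimately have "bij_betw (mult_aut n k) (carrier ?Z) (carrier ?Z)"
    using into by (simp add: bij_betw_def endo_inj_surj image_subset_iff_funcset)
  moreover have "mult_aut n k \<in> hom ?Z ?Z"
    using into assms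
    by (auto simp: hom_def mult_aut_def c mod_simps distrib_left)
  ultimately show ?thesis
    by (simp add: AutoGroup_def auto_def Bij_def mult_aut_def)
qed

end

theory Submission
  imports Defs "HOL-Algebra.Multiplicative_Group" "HOL-Number_Theory.Cong"
begin

text \<open>
  The subgroup is generated by two classes \<open>c\<close> and \<open>t\<close> with \<open>c\<close> of order \<open>n\<close>, with
  \<open>t c t\<^sup>-\<^sup>1 = c\<^sup>k\<close>, and with \<open>t\<close> of infinite order independently of \<open>c\<close>.

  The elements \<open>\<rho>\<^sub>1, \<dots>, \<rho>\<^sub>n\<^sub>-\<^sub>1\<close> generate a copy of \<open>S\<^sub>n\<close> in \<open>VB\<^sub>n\<close> on which the projection
  \<open>VB\<^sub>n \<rightarrow> S\<^sub>n\<close> is an isomorphism (\<open>coxeter_symmetric_iso\<close>). On the residues modulo \<open>n\<close> the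
  translation by 1 and the multiplication by \<open>k\<close> are permutations, and conjugating the former by
  the latter gives its \<open>k\<close>-th power. Their lifts \<open>c\<close> and \<open>\<theta>\<close> to that copy of \<open>S\<^sub>n\<close> satisfy the
  same relations in \<open>VB\<^sub>n\<close>, but \<open>\<theta>\<close> has finite order.

  To repair this, \<open>\<theta>\<close> is multiplied by an element \<open>v\<close> of \<open>VP\<^sub>n\<close> that commutes with \<open>c\<close> modulo
  \<open>\<Gamma>\<^sub>2(VP\<^sub>n)\<close>. Put \<open>\<lambda> = \<sigma>\<^sub>1 \<rho>\<^sub>1\<close>, which lies in \<open>VP\<^sub>n\<close>, and \<open>v = (\<lambda> c)\<^sup>n\<close>, the product of the
  conjugates of \<open>\<lambda>\<close> by \<open>1, c, \<dots>, c\<^sup>n\<^sup>-\<^sup>1\<close>. Both \<open>v\<close> and \<open>\<lambda>\<close> lie in \<open>VP\<^sub>n\<close>, so they commute modulo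
  \<open>\<Gamma>\<^sub>2(VP\<^sub>n)\<close>; as \<open>v\<close> also commutes with \<open>\<lambda> c\<close>, it commutes with \<open>c\<close>. Hence \<open>t = v \<theta>\<close> still
  conjugates \<open>c\<close> to \<open>c\<^sup>k\<close>.

  Two homomorphisms that are trivial on \<open>\<Gamma>\<^sub>2(VP\<^sub>n)\<close> show that nothing else collapses. The degree
  \<open>\<sigma>\<^sub>i \<mapsto> 1, \<rho>\<^sub>i \<mapsto> 0\<close> sends \<open>c\<^sup>a t\<^sup>b\<close> to \<open>n b\<close>, and the projection to \<open>S\<^sub>n\<close> sends \<open>c\<^sup>a\<close> to a power of
  an \<open>n\<close>-cycle, so \<open>c\<^sup>a t\<^sup>b = 1\<close> forces \<open>b = 0\<close> and \<open>n\<close> to divide \<open>a\<close>. The general form of this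
  argument is \<open>Zn_semidirect_Z_mod_derived_kernel\<close>.
\<close>

section \<open>Semidirect products\<close>

lemma AutoGroup_hom: "f \<in> carrier (AutoGroup N) \<Longrightarrow> f \<in> hom N N"
  by (simp add: AutoGroup_def auto_def)

lemma AutoGroup_mult_apply:
  assumes "f \<in> carrier (AutoGroup N)" "g \<in> carrier (AutoGroup N)" "x \<in> carrier N"
  shows "(f \<otimes>\<^bsub>AutoGroup N\<^esub> g) x = f (g x)"
  using assms by (simp add: AutoGroup_def auto_def BijGroup_def compose_def)

lemma AutoGroup_one_apply: "x \<in> carrier N \<Longrightarrow> \<one>\<^bsub>AutoGroup N\<^esub> x = x"
  by (simp add: AutoGroup_def BijGroup_def)

locale group_action_by_automorphisms = N: group N + H: group H + \<phi>: group_hom H "AutoGroup N" \<phi>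
  for N (structure) and H (structure) and \<phi>
begin

\<comment> \<open>As rewrite rules these would replace the action of a product by a product in \<open>AutoGroup N\<close>,
  out of reach of the rules for the action.\<close>
declare \<phi>.hom_inv [simp del] \<phi>.hom_one [simp del] \<phi>.hom_mult [simp del]

lemma action_closed [simp]: "g \<in> carrier H \<Longrightarrow> x \<in> carrier N \<Longrightarrow> \<phi> g x \<in> carrier N"
  using AutoGroup_hom[OF \<phi>.hom_closed] hom_in_carrier by metis

lemma action_mult:
  "g \<in> carrier H \<Longrightarrow> x \<in> carrier N \<Longrightarrow> y \<in> carrier N \<Longrightarrow> \<phi> g (x \<otimes>\<^bsub>N\<^esub> y) = \<phi> g x \<otimes>\<^bsub>N\<^esub> \<phi> g y"
  using AutoGroup_hom[OF \<phi>.hom_closed] hom_mult by metis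

lemma action_one: "g \<in> carrier H \<Longrightarrow> \<phi> g \<one>\<^bsub>N\<^esub> = \<one>\<^bsub>N\<^esub>"
  using hom_one[OF AutoGroup_hom[OF \<phi>.hom_closed]] N.is_group by simp

lemma action_action:
  "g \<in> carrier H \<Longrightarrow> h \<in> carrier H \<Longrightarrow> x \<in> carrier N \<Longrightarrow> \<phi> g (\<phi> h x) = \<phi> (g \<otimes>\<^bsub>H\<^esub> h) x"
  by (simp add: AutoGroup_mult_apply \<phi>.hom_mult)

lemma one_action [simp]: "x \<in> carrier N \<Longrightarrow> \<phi> \<one>\<^bsub>H\<^esub> x = x"
  by (simp add: AutoGroup_one_apply \<phi>.hom_one)

abbreviation "SD \<equiv> semidirect_product N H \<phi>"

lemma SD_carrier: "carrier SD = carrier N \<times> carrier H"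
  by (simp add: semidirect_product_def)

lemma SD_mult: "(a, g) \<otimes>\<^bsub>SD\<^esub> (b, h) = (a \<otimes>\<^bsub>N\<^esub> \<phi> g b, g \<otimes>\<^bsub>H\<^esub> h)"
  by (simp add: semidirect_product_def)

lemma SD_one: "\<one>\<^bsub>SD\<^esub> = (\<one>\<^bsub>N\<^esub>, \<one>\<^bsub>H\<^esub>)"
  by (simp add: semidirect_product_def)

lemma group_semidirect_product: "group SD"
proof (rule groupI)
  fix x assume "x \<in> carrier SD"
  then obtain a g where x: "x = (a, g)" "a \<in> carrier N" "g \<in> carrier H" by (auto simp: SD_carrier)
  show "\<exists>y \<in> carrier SD. y \<otimes>\<^bsub>SD\<^esub> x = \<one>\<^bsub>SD\<^esub>"
    using x by (intro bexI[of _ "(\<phi> (inv\<^bsub>H\<^esub> g) (inv\<^bsub>N\<^esub> a), inv\<^bsub>H\<^esub> g)"])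
      (simp_all add: SD_mult SD_one SD_carrier action_mult[symmetric] action_one)
qed (auto simp: SD_carrier SD_mult SD_one N.m_assoc H.m_assoc action_mult action_action)

text \<open>
  The acting group, embedded as the second factor, is the required cyclic subgroup: each of its
  right cosets meets the normal factor, so there are at most as many cosets as elements of \<open>N\<close>.
\<close>

lemma virtually_cyclic_semidirect_product:
  assumes "finite (carrier N)" "cyclic_group H"
  shows "virtually_cyclic SD"
proof -
  interpret SD: group SD by (rule group_semidirect_product)
  let ?C = "{\<one>\<^bsub>N\<^esub>} \<times> carrier H"
  have emb: "Pair \<one>\<^bsub>N\<^esub> \<in> hom H SD"
    by (intro homI) (auto simp: SD_carrier SD_mult action_one)
  have img: "Pair \<one>\<^bsub>N\<^esub> ` carrier H = ?C" by auto
  have C: "subgroup ?C SD"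
    using group_hom.img_is_subgroup[of H SD "Pair \<one>\<^bsub>N\<^esub>"] emb
    by (simp add: group_hom_def group_hom_axioms_def img SD.is_group H.is_group)
  have "cyclic_group (SD\<lparr>carrier := ?C\<rparr>)"
  proof (rule H.cyclic_group_epimorphic_image)
    show "Pair \<one>\<^bsub>N\<^esub> \<in> epi H (SD\<lparr>carrier := ?C\<rparr>)"
      using emb img by (auto simp: epi_def hom_def)
    show "group (SD\<lparr>carrier := ?C\<rparr>)" using C by (rule SD.subgroup_imp_group)
  qed (rule assms)
  moreover have "rcosets\<^bsub>SD\<^esub> ?C \<subseteq> (\<lambda>y. ?C #>\<^bsub>SD\<^esub> (y, \<one>\<^bsub>H\<^esub>)) ` carrier N"
  proof
    fix X assume "X \<in> rcosets\<^bsub>SD\<^esub> ?C"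
    then obtain a g where X: "a \<in> carrier N" "g \<in> carrier H" "X = ?C #>\<^bsub>SD\<^esub> (a, g)"
      by (auto simp: RCOSETS_def SD_carrier)
    \<comment> \<open>Moving \<open>g\<close> to the left past \<open>a\<close> twists \<open>a\<close> by the inverse of \<open>g\<close>.\<close>
    let ?y = "\<phi> (inv\<^bsub>H\<^esub> g) a"
    have "(a, g) = (\<one>\<^bsub>N\<^esub>, g) \<otimes>\<^bsub>SD\<^esub> (?y, \<one>\<^bsub>H\<^esub>)"
      using X by (simp add: SD_mult action_action)
    then have "(a, g) \<in> ?C #>\<^bsub>SD\<^esub> (?y, \<one>\<^bsub>H\<^esub>)"
      using X by (auto simp: r_coset_def)
    then have "X = ?C #>\<^bsub>SD\<^esub> (?y, \<one>\<^bsub>H\<^esub>)"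
      using SD.repr_independence[OF _ _ C] X by (simp add: SD_carrier)
    then show "X \<in> (\<lambda>y. ?C #>\<^bsub>SD\<^esub> (y, \<one>\<^bsub>H\<^esub>)) ` carrier N"
      using X by auto
  qed
  ultimately show ?thesis
    unfolding virtually_cyclic_def
    using C SD.is_group finite_subset assms(1) by blast
qed

end

lemma mult_aut_powers_action:
  assumes "n \<ge> 1" "gcd n k = 1"
  shows "group_action_by_automorphisms (integer_mod_group n) integer_group
    (\<lambda>m :: int. mult_aut n k [^]\<^bsub>AutoGroup (integer_mod_group n)\<^esub> m)"
  using group.hom_integer_group_pow[OF group.AutoGroup mult_aut_in_AutoGroup[OF assms]]
  by (simp add: group_action_by_automorphisms_def group_hom_def group_hom_axioms_def group.AutoGroup)

lemma virtually_cyclic_Zn_semidirect_Z: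
  assumes "n \<ge> 1" "gcd n k = 1"
  shows "virtually_cyclic (Zn_semidirect_Z n k)"
  unfolding Zn_semidirect_Z_def
  using assms
  by (intro group_action_by_automorphisms.virtually_cyclic_semidirect_product
      mult_aut_powers_action) (simp_all add: carrier_integer_mod_group)

section \<open>Pairs of elements that generate a semidirect product\<close>

lemma (in group) conj_int_pow:
  assumes "x \<in> carrier G" "y \<in> carrier G" "z \<in> carrier G" "x \<otimes> y = z \<otimes> x"
  shows "x \<otimes> y [^] (i :: int) = z [^] i \<otimes> x"
proof -
  let ?\<kappa> = "\<lambda>g. x \<otimes> g \<otimes> inv x"
  have "inv x \<otimes> (x \<otimes> g) = g" if "g \<in> carrier G" for g
    using assms(1) that by (simp flip: m_assoc)
  then have "?\<kappa> \<in> hom G G"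
    using assms(1) by (intro homI) (simp_all add: m_assoc)
  then interpret \<kappa>: group_hom G G ?\<kappa>
    by unfold_locales
  have "?\<kappa> y = z" using assms by (simp add: m_assoc)
  then have "?\<kappa> (y [^] i) = z [^] i"
    using \<kappa>.hom_int_pow[of y i] assms by simp
  then show ?thesis
    using assms by (metis inv_solve_right' int_pow_closed m_closed)
qed

text \<open>
  The relations \<open>c_pow\<close> and \<open>t_c\<close> present \<open>\<int>\<^sub>n \<rtimes> \<int>\<close>, so they yield a homomorphism from it, which
  \<open>independent\<close> makes injective.
\<close>

locale Zn_Z_pair = group G for G (structure) +
  fixes n k :: nat and c t :: 'a
  assumes n_pos: "n \<ge> 1" and gcd: "gcd n k = 1"
    and c [simp]: "c \<in> carrier G" and t [simp]: "t \<in> carrier G"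
    and c_pow: "c [^] n = \<one>"
    and t_c: "t \<otimes> c = c [^] k \<otimes> t"
    and independent: "\<And>a b :: int. c [^] a \<otimes> t [^] b = \<one> \<Longrightarrow> int n dvd a \<and> b = 0"
begin

abbreviation "Zn \<equiv> integer_mod_group n"
abbreviation "act m \<equiv> mult_aut n k [^]\<^bsub>AutoGroup Zn\<^esub> (m :: int)"

sublocale act: group_action_by_automorphisms Zn integer_group act
  using mult_aut_powers_action[OF n_pos gcd] .

lemma c_pow_mod: "c [^] (a mod int n) = c [^] a"
proof -
  have "c [^] a = c [^] (int n * (a div int n) + a mod int n)" by simp
  also have "\<dots> = (c [^] int n) [^] (a div int n) \<otimes> c [^] (a mod int n)"
    by (simp only: int_pow_mult int_pow_pow c)
  also have "c [^] int n = \<one>" using c_pow by (simp add: int_pow_int)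
  finally show ?thesis by simp
qed

lemma t_c_pow: "a \<in> carrier Zn \<Longrightarrow> t \<otimes> c [^] a = c [^] act 1 a \<otimes> t"
proof -
  assume a: "a \<in> carrier Zn"
  have "t \<otimes> c [^] a = (c [^] k) [^] a \<otimes> t"
    by (rule conj_int_pow) (simp_all add: t_c)
  also have "(c [^] k) [^] a = c [^] (int k * a)"
    by (simp add: int_pow_pow flip: int_pow_int)
  also have "\<dots> = c [^] act 1 a"
    using a group.int_pow_1[OF group.AutoGroup mult_aut_in_AutoGroup[OF n_pos gcd]]
    by (simp add: mult_aut_def c_pow_mod)
  finally show ?thesis .
qed

text \<open>
  This is the commutation rule that turns \<open>(a, m) \<mapsto> c\<^sup>a t\<^sup>m\<close> into a homomorphism. Negative
  exponents \<open>m\<close> reduce to the relation for \<open>t\<close> itself because \<open>\<alpha>\<^sub>k\<close> is bijective: \<open>a\<close> is the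
  image of some \<open>b\<close>, and \<open>c\<^sup>a t = t c\<^sup>b\<close>.
\<close>

lemma t_pow_c_pow: "a \<in> carrier Zn \<Longrightarrow> t [^] m \<otimes> c [^] a = c [^] act m a \<otimes> t [^] m"
proof (induction m arbitrary: a rule: int_induct[where k = 0])
  case base
  then show ?case using act.one_action by simp
next
  case (step1 i)
  have a: "act 1 a \<in> carrier Zn" using step1(3) by simp
  have "t [^] (i + 1) \<otimes> c [^] a = t [^] i \<otimes> (t \<otimes> c [^] a)"
    by (simp add: int_pow_mult m_assoc)
  also have "\<dots> = (t [^] i \<otimes> c [^] act 1 a) \<otimes> t"
    using step1(3) by (simp add: t_c_pow m_assoc)
  also have "\<dots> = c [^] act i (act 1 a) \<otimes> t [^] (i + 1)"
    using step1(2)[OF a] by (simp add: int_pow_mult m_assoc)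
  also have "act i (act 1 a) = act (i + 1) a"
    using step1 act.action_action[of i 1 a] by simp
  finally show ?case .
next
  case (step2 i)
  define b where "b = act (- 1) a"
  have b: "b \<in> carrier Zn" "a = act 1 b" "act i b = act (i - 1) a"
    unfolding b_def using step2 act.action_closed[of "- 1" a] act.action_action[of 1 "- 1" a]
      act.action_action[of i "- 1" a] act.one_action[of a] by simp_all
  have "t [^] (i - 1) \<otimes> c [^] a \<otimes> t = t [^] (i - 1) \<otimes> (t \<otimes> c [^] b)"
    using b t_c_pow[of b] by (simp add: m_assoc)
  also have "\<dots> = t [^] (i - 1 + 1) \<otimes> c [^] b"
    by (simp only: int_pow_mult m_assoc t c int_pow_closed int_pow_1)
  also have "\<dots> = c [^] act (i - 1) a \<otimes> t [^] (i - 1 + 1)"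
    using step2 b by simp
  also have "\<dots> = c [^] act (i - 1) a \<otimes> t [^] (i - 1) \<otimes> t"
    by (simp only: int_pow_mult m_assoc t c int_pow_closed int_pow_1)
  finally show ?case by (simp only: right_cancel m_closed int_pow_closed t c)
qed

definition realize :: "int \<times> int \<Rightarrow> 'a"
  where "realize = (\<lambda>(a, m). c [^] a \<otimes> t [^] m)"

lemma Zn_semidirect_Z_embeds:
  "\<exists>H. subgroup H G \<and> G\<lparr>carrier := H\<rparr> \<cong> Zn_semidirect_Z n k"
proof -
  have Z: "Zn_semidirect_Z n k = act.SD" by (simp add: Zn_semidirect_Z_def)
  have hom: "realize \<in> hom act.SD G"
  proof (rule homI)
    fix x y assume "x \<in> carrier act.SD" "y \<in> carrier act.SD"
    then obtain a l b m where xy: "x = (a, l)" "y = (b, m)" "a \<in> carrier Zn" "b \<in> carrier Zn"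
      by (auto simp: act.SD_carrier)
    have "realize x \<otimes> realize y = c [^] a \<otimes> (t [^] l \<otimes> c [^] b) \<otimes> t [^] m"
      by (simp add: xy realize_def m_assoc)
    also have "\<dots> = (c [^] a \<otimes> c [^] act l b) \<otimes> (t [^] l \<otimes> t [^] m)"
      using xy by (simp add: t_pow_c_pow m_assoc)
    also have "\<dots> = realize (x \<otimes>\<^bsub>act.SD\<^esub> y)"
      by (simp add: xy act.SD_mult realize_def c_pow_mod int_pow_mult)
    finally show "realize (x \<otimes>\<^bsub>act.SD\<^esub> y) = realize x \<otimes> realize y" ..
  qed (auto simp: realize_def)
  interpret f: group_hom act.SD G realize
    using act.group_semidirect_product hom is_group
    by (simp add: group_hom_def group_hom_axioms_def)
  have "inj_on realize (carrier act.SD)"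
    unfolding f.inj_on_one_iff
  proof (intro strip)
    fix x assume x: "x \<in> carrier act.SD" "realize x = \<one>"
    obtain a m where am: "x = (a, m)" by (cases x)
    then have "a \<in> {0..<int n}" "int n dvd a" "m = 0"
      using x independent[of a m] n_pos
      by (auto simp: realize_def act.SD_carrier carrier_integer_mod_group)
    then show "x = \<one>\<^bsub>act.SD\<^esub>"
      using zdvd_not_zless[of a "int n"] by (force simp: am act.SD_one)
  qed
  then have "realize \<in> iso act.SD (G\<lparr>carrier := realize ` carrier act.SD\<rparr>)"
    using hom by (auto simp: Group.iso_iff hom_def)
  then have "G\<lparr>carrier := realize ` carrier act.SD\<rparr> \<cong> Zn_semidirect_Z n k"
    unfolding Z using group.iso_sym[OF act.group_semidirect_product is_isoI] by blast
  then show ?thesis using f.img_is_subgroup by blast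
qed

end

section \<open>A lifting criterion modulo the commutators of a kernel\<close>

lemma (in group) derived_commute_mod:
  assumes K: "K \<lhd> G" and x: "x \<in> K" and y: "y \<in> K"
  shows "derived G K #> (x \<otimes> y) = derived G K #> (y \<otimes> x)"
proof -
  have D: "subgroup (derived G K) G"
    using derived_is_normal[OF K] by (simp add: normal_imp_subgroup)
  have carr: "x \<in> carrier G" "y \<in> carrier G"
    using x y subgroup.subset[OF normal_imp_subgroup[OF K]] by auto
  have "x \<otimes> y \<otimes> inv x \<otimes> inv y \<in> derived G K"
    unfolding derived_def using x y by (intro generate.incl) auto
  moreover have "x \<otimes> y = (x \<otimes> y \<otimes> inv x \<otimes> inv y) \<otimes> (y \<otimes> x)"
    using carr by (simp add: inv_solve_right' m_assoc inv_mult_group[symmetric] del: inv_mult_group)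
  ultimately have "x \<otimes> y \<in> derived G K #> (y \<otimes> x)"
    unfolding r_coset_def by blast
  then show ?thesis
    using repr_independence[OF _ _ D] carr by simp
qed

text \<open>
  The power commutes with its base \<open>x y\<close>, and with \<open>x\<close> by assumption, hence with the remaining
  factor \<open>y\<close>.
\<close>

lemma (in group) commutes_pow_of_mult:
  assumes x: "x \<in> carrier G" and y: "y \<in> carrier G"
    and xv: "x \<otimes> (x \<otimes> y) [^] (n :: nat) = (x \<otimes> y) [^] n \<otimes> x"
  shows "y \<otimes> (x \<otimes> y) [^] n = (x \<otimes> y) [^] n \<otimes> y"
proof -
  define v where "v = (x \<otimes> y) [^] n"
  have v: "v \<in> carrier G" unfolding v_def using x y by simp
  have "x \<otimes> (y \<otimes> v) = x \<otimes> y \<otimes> v" using x y v by (simp add: m_assoc)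
  also have "\<dots> = v \<otimes> x \<otimes> y"
    unfolding v_def using x y nat_pow_Suc2[of "x \<otimes> y" n] by (simp add: m_assoc)
  also have "v \<otimes> x = x \<otimes> v" using xv by (simp add: v_def)
  also have "x \<otimes> v \<otimes> y = x \<otimes> (v \<otimes> y)" using x y v by (simp add: m_assoc)
  finally show ?thesis using x y v by (simp add: v_def)
qed

text \<open>
  The kernel of \<open>\<pi>\<close> becomes abelian modulo its commutators. This makes the norm of \<open>l\<close> under
  conjugation by \<open>c\<close> a \<open>c\<close>-invariant element, by which \<open>\<theta>\<close> can be multiplied without changing
  its action on \<open>c\<close>. The norm has degree \<open>n d(l) \<noteq> 0\<close>, which gives the product infinite order.
\<close>

lemma Zn_semidirect_Z_mod_derived_kernel:
  fixes G (structure) and n k :: nat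
  assumes \<pi>: "group_hom G S \<pi>" and d: "group_hom G integer_group d"
    and n: "n \<ge> 1" "gcd n k = 1"
    and c: "c \<in> carrier G" "c [^] n = \<one>" "group.ord S (\<pi> c) = n" "d c = 0"
    and \<theta>: "\<theta> \<in> carrier G" "\<theta> \<otimes> c = c [^] k \<otimes> \<theta>" "d \<theta> = 0"
    and l: "l \<in> kernel G S \<pi>" "d l \<noteq> 0"
  shows "\<exists>H. subgroup H (G Mod derived G (kernel G S \<pi>)) \<and>
    (G Mod derived G (kernel G S \<pi>))\<lparr>carrier := H\<rparr> \<cong> Zn_semidirect_Z n k"
proof -
  interpret \<pi>: group_hom G S \<pi> by fact
  interpret d: group_hom G integer_group d by fact
  let ?K = "kernel G S \<pi>"
  let ?D = "derived G ?K"
  let ?Q = "G Mod ?D"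
  define q where "q g = ?D #> g" for g
  have K: "?K \<lhd> G" by (rule \<pi>.normal_kernel)
  interpret D: normal ?D G by (rule \<pi>.G.derived_is_normal[OF K])
  interpret q: group_hom G ?Q q
    unfolding q_def
    by (intro group_hom.intro group_hom_axioms.intro \<pi>.G.is_group D.factorgroup_is_group D.r_coset_hom_Mod)
  note mult_FactGroup [simp del] one_FactGroup [simp del]
  have lc: "l \<in> carrier G" and \<pi>l: "\<pi> l = \<one>\<^bsub>S\<^esub>" using l by (auto simp: kernel_def)
  \<comment> \<open>As \<open>c\<close> has order \<open>n\<close>, this power is the norm \<open>l (c l c\<^sup>-\<^sup>1) \<dots> (c\<^sup>n\<^sup>-\<^sup>1 l c\<^sup>1\<^sup>-\<^sup>n)\<close>.\<close>
  define v where "v = (l \<otimes> c) [^] n"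
  have vc: "v \<in> carrier G" unfolding v_def using lc c by simp
  have "\<pi> v = \<pi> (c [^] n)"
    unfolding v_def using lc c(1) \<pi>l by (simp add: \<pi>.hom_nat_pow)
  then have "\<pi> v = \<one>\<^bsub>S\<^esub>" unfolding c(2) by simp
  then have v: "v \<in> ?K" using vc by (simp add: kernel_def)
  have dv: "d v = int n * d l"
    unfolding v_def using lc c by (simp add: d.hom_nat_pow)
  have "q (l \<otimes> v) = q (v \<otimes> l)"
    unfolding q_def by (rule \<pi>.G.derived_commute_mod[OF K l(1) v])
  then have qlv: "q l \<otimes>\<^bsub>?Q\<^esub> q v = q v \<otimes>\<^bsub>?Q\<^esub> q l" using lc vc by simp
  have qv: "q v = (q l \<otimes>\<^bsub>?Q\<^esub> q c) [^]\<^bsub>?Q\<^esub> n"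
    unfolding v_def using lc c by (simp add: q.hom_nat_pow)
  have qcv: "q c \<otimes>\<^bsub>?Q\<^esub> q v = q v \<otimes>\<^bsub>?Q\<^esub> q c"
    using q.H.commutes_pow_of_mult[of "q l" "q c" n] lc c qlv by (simp flip: qv)
  have qcv': "q c [^]\<^bsub>?Q\<^esub> k \<otimes>\<^bsub>?Q\<^esub> q v = q v \<otimes>\<^bsub>?Q\<^esub> q c [^]\<^bsub>?Q\<^esub> k"
    using qcv c vc by (intro q.H.group_commutes_pow) auto
  define t where "t = v \<otimes> \<theta>"
  have tc: "t \<in> carrier G" unfolding t_def using vc \<theta> by simp
  have qt: "q t \<otimes>\<^bsub>?Q\<^esub> q c = q c [^]\<^bsub>?Q\<^esub> k \<otimes>\<^bsub>?Q\<^esub> q t"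
  proof -
    have "q t \<otimes>\<^bsub>?Q\<^esub> q c = q v \<otimes>\<^bsub>?Q\<^esub> q (\<theta> \<otimes> c)"
      unfolding t_def using vc \<theta>(1) c by (simp add: q.H.m_assoc)
    also have "\<dots> = q v \<otimes>\<^bsub>?Q\<^esub> q c [^]\<^bsub>?Q\<^esub> k \<otimes>\<^bsub>?Q\<^esub> q \<theta>"
      unfolding \<theta>(2) using vc \<theta>(1) c by (simp add: q.H.m_assoc q.hom_nat_pow)
    also have "\<dots> = q c [^]\<^bsub>?Q\<^esub> k \<otimes>\<^bsub>?Q\<^esub> q t"
      unfolding t_def qcv'[symmetric] using vc \<theta>(1) c by (simp add: q.H.m_assoc)
    finally show ?thesis .
  qed
  have D_K: "?D \<subseteq> ?K"
    by (rule \<pi>.G.derived_incl[OF order_refl \<pi>.subgroup_kernel])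
  \<comment> \<open>The target of \<open>d\<close> is abelian.\<close>
  have D_d: "?D \<subseteq> kernel G integer_group d"
    unfolding derived_def
  proof (rule \<pi>.G.generate_subgroup_incl[OF _ d.subgroup_kernel])
    show "derived_set G ?K \<subseteq> kernel G integer_group d"
      by (auto simp: kernel_def)
  qed
  have indep: "int n dvd a \<and> b = 0"
    if "q c [^]\<^bsub>?Q\<^esub> a \<otimes>\<^bsub>?Q\<^esub> q t [^]\<^bsub>?Q\<^esub> b = \<one>\<^bsub>?Q\<^esub>" for a b :: int
  proof -
    let ?g = "c [^] a \<otimes> t [^] b"
    have "q ?g = ?D"
      using that c tc by (simp add: q.hom_int_pow one_FactGroup)
    then have g: "?g \<in> ?D"
      using \<pi>.G.coset_join1[OF _ _ D.subgroup_axioms] c tc by (simp add: q_def)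
    have "d ?g = 0" using g D_d by (auto simp: kernel_def)
    then have "b * (int n * d l) = 0"
      using c tc vc \<theta> dv by (simp add: d.hom_int_pow t_def)
    then have b: "b = 0" using n l by simp
    have "\<pi> ?g = \<one>\<^bsub>S\<^esub>" using g D_K by (auto simp: kernel_def)
    then have "\<pi> c [^]\<^bsub>S\<^esub> a = \<one>\<^bsub>S\<^esub>" using b c by (simp add: \<pi>.hom_int_pow)
    then show ?thesis using \<pi>.H.int_pow_eq_id[of "\<pi> c" a] c b by simp
  qed
  interpret Zn_Z_pair ?Q n k "q c" "q t"
    using n c tc qt indep q.hom_nat_pow[of c n] by unfold_locales auto
  show ?thesis by (rule Zn_semidirect_Z_embeds)
qed


section \<open>The Coxeter presentation of the symmetric group\<close>

text \<open>
  These are the Coxeter relations of \<open>S\<^sub>m\<^sub>+\<^sub>1\<close>. They determine \<open>S\<^sub>m\<^sub>+\<^sub>1\<close>, in the following sense: any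
  homomorphism to it that sends the \<open>i\<close>-th element to the
  \<open>i\<close>-th adjacent transposition is injective on the subgroup that they generate.
\<close>

locale type_A_coxeter = group G for G (structure) +
  fixes r :: "nat \<Rightarrow> 'a" and m :: nat
  assumes r_closed [simp]: "i \<in> {1..m} \<Longrightarrow> r i \<in> carrier G"
    and r_involution: "i \<in> {1..m} \<Longrightarrow> r i \<otimes> r i = \<one>"
    and r_braid: "1 \<le> i \<Longrightarrow> i < m \<Longrightarrow> r i \<otimes> r (Suc i) \<otimes> r i = r (Suc i) \<otimes> r i \<otimes> r (Suc i)"
    and r_commute: "1 \<le> i \<Longrightarrow> Suc i < j \<Longrightarrow> j \<le> m \<Longrightarrow> r i \<otimes> r j = r j \<otimes> r i"
begin

definition parabolic :: "nat \<Rightarrow> 'a set"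
  where "parabolic k = generate G (r ` {1..k})"

text \<open>
  The word \<open>r\<^sub>k r\<^sub>k\<^sub>-\<^sub>1 \<dots> r\<^sub>j\<close>, empty for \<open>j > k\<close>. For \<open>j = 1, \<dots>, k + 1\<close> these words
  represent the right cosets of \<open>\<langle>r\<^sub>1, \<dots>, r\<^sub>k\<^sub>-\<^sub>1\<rangle>\<close> in \<open>\<langle>r\<^sub>1, \<dots>, r\<^sub>k\<rangle>\<close>; in the symmetric group
  they are told apart by the preimage \<open>j\<close> of \<open>k + 1\<close>.
\<close>

fun descending :: "nat \<Rightarrow> nat \<Rightarrow> 'a"
  where
    "descending 0 j = \<one>"
  | "descending (Suc k) j = (if j \<le> Suc k then r (Suc k) \<otimes> descending k j else \<one>)"

lemma descending_closed [simp]: "k \<le> m \<Longrightarrow> descending k j \<in> carrier G"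
  by (induction k) auto

lemma descending_empty: "k < j \<Longrightarrow> descending k j = \<one>"
  by (cases k) auto

lemma r_inverse: "i \<in> {1..m} \<Longrightarrow> inv (r i) = r i"
  by (simp add: inv_equality r_involution)

lemma parabolic_subgroup: "k \<le> m \<Longrightarrow> subgroup (parabolic k) G"
  unfolding parabolic_def by (rule generate_is_subgroup) auto

lemma r_in_parabolic: "i \<in> {1..k} \<Longrightarrow> r i \<in> parabolic k"
  unfolding parabolic_def by (intro generate.incl) auto

lemma parabolic_mono: "k \<le> k' \<Longrightarrow> parabolic k \<subseteq> parabolic k'"
  unfolding parabolic_def by (intro mono_generate image_mono) auto

lemma descending_in_parabolic: "k \<le> m \<Longrightarrow> 1 \<le> j \<Longrightarrow> descending k j \<in> parabolic k"
proof (induction k)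
  case 0
  then show ?case by (simp add: subgroup.one_closed[OF parabolic_subgroup])
next
  case (Suc k)
  then have "descending k j \<in> parabolic (Suc k)"
    using parabolic_mono[of k "Suc k"] by auto
  moreover have "r (Suc k) \<in> parabolic (Suc k)"
    by (rule r_in_parabolic) simp
  ultimately show ?case
    using Suc.prems parabolic_subgroup[of "Suc k"]
    by (simp add: subgroup.m_closed subgroup.one_closed)
qed

lemma r_commute': "i \<in> {1..m} \<Longrightarrow> j \<in> {1..m} \<Longrightarrow> Suc i < j \<or> Suc j < i \<Longrightarrow> r i \<otimes> r j = r j \<otimes> r i"
  using r_commute[of i j] r_commute[of j i] by auto

lemma descending_commute:
  assumes "i \<in> {1..m}" "k \<le> m" "1 \<le> j" "Suc k < i \<or> Suc i < j"
  shows "descending k j \<otimes> r i = r i \<otimes> descending k j"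
  using assms(2,4)
proof (induction k)
  case 0
  then show ?case using assms by simp
next
  case (Suc k)
  show ?case
  proof (cases "j \<le> Suc k")
    case True
    have "descending k j \<otimes> r i = r i \<otimes> descending k j"
      using Suc.prems by (intro Suc.IH) auto
    then have "r (Suc k) \<otimes> descending k j \<otimes> r i = r (Suc k) \<otimes> (r i \<otimes> descending k j)"
      using Suc.prems assms(1) by (simp add: m_assoc)
    also have "\<dots> = r (Suc k) \<otimes> r i \<otimes> descending k j"
      using Suc.prems assms by (simp add: m_assoc)
    also have "r (Suc k) \<otimes> r i = r i \<otimes> r (Suc k)"
      using Suc.prems assms True by (intro r_commute') auto
    finally show ?thesis using Suc.prems assms True by (simp add: m_assoc)
  next
    case False
    then show ?thesis using assms by simp
  qed
qed

lemma descending_extend: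
  assumes "1 \<le> i" "i \<le> k" "k \<le> m"
  shows "descending k (Suc i) \<otimes> r i = descending k i"
  using assms(2,3)
proof (induction k)
  case (Suc k)
  show ?case
  proof (cases "i = Suc k")
    case True
    then show ?thesis using Suc.prems by (simp add: descending_empty)
  next
    case False
    then show ?thesis using Suc assms(1) by (simp add: m_assoc)
  qed
qed (use assms in simp)

lemma descending_shorten:
  assumes "1 \<le> i" "i \<le> k" "k \<le> m"
  shows "descending k i \<otimes> r i = descending k (Suc i)"
  using assms by (simp add: descending_extend[symmetric] m_assoc r_involution)

text \<open>
  The letter \<open>r\<^sub>i\<^sub>+\<^sub>1\<close> moves left through \<open>r\<^sub>i\<^sub>-\<^sub>1 \<dots> r\<^sub>j\<close>, meets \<open>r\<^sub>i\<^sub>+\<^sub>1 r\<^sub>i\<close>, and the braid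
  relation turns it into an \<open>r\<^sub>i\<close> on the left, which commutes with all earlier letters.
\<close>

lemma descending_shift:
  assumes "1 \<le> j" "j \<le> i" "i < k" "k \<le> m"
  shows "descending k j \<otimes> r (Suc i) = r i \<otimes> descending k j"
  using assms(3,4)
proof (induction k)
  case (Suc k)
  show ?case
  proof (cases "i = k")
    case False
    then have "descending (Suc k) j \<otimes> r (Suc i) = r (Suc k) \<otimes> (r i \<otimes> descending k j)"
      using Suc assms(1,2) by (simp add: m_assoc)
    also have "\<dots> = (r (Suc k) \<otimes> r i) \<otimes> descending k j"
      using Suc.prems assms(1,2) by (simp add: m_assoc)
    also have "r (Suc k) \<otimes> r i = r i \<otimes> r (Suc k)"
      using Suc.prems assms(1,2) False by (intro r_commute') auto
    finally show ?thesis using Suc.prems assms(1,2) by (simp add: m_assoc)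
  next
    case True
    then obtain l where k: "k = Suc l" using assms by (cases k) auto
    have "descending (Suc k) j \<otimes> r (Suc i) = r (Suc k) \<otimes> (r k \<otimes> (descending l j \<otimes> r (Suc k)))"
      using True k Suc.prems assms(1,2) by (simp add: m_assoc)
    also have "descending l j \<otimes> r (Suc k) = r (Suc k) \<otimes> descending l j"
      using k Suc.prems assms(1) by (intro descending_commute) auto
    also have "r (Suc k) \<otimes> (r k \<otimes> (r (Suc k) \<otimes> descending l j))
        = (r (Suc k) \<otimes> r k \<otimes> r (Suc k)) \<otimes> descending l j"
      using k Suc.prems by (simp add: m_assoc)
    also have "r (Suc k) \<otimes> r k \<otimes> r (Suc k) = r k \<otimes> r (Suc k) \<otimes> r k"
      using k Suc.prems by (intro r_braid[symmetric]) auto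
    finally show ?thesis using True k Suc.prems assms(1,2) by (simp add: m_assoc)
  qed
qed (use assms in simp)

text \<open>
  A generator on the right of \<open>r\<^sub>k\<^sub>+\<^sub>1 \<dots> r\<^sub>j\<close> lengthens the word, shortens it, or passes through
  it to the left; in the last case it comes out with index at most \<open>k\<close>.
\<close>

lemma descending_absorb:
  assumes "k < m" "j \<in> {1..Suc (Suc k)}" "i \<in> {1..Suc k}"
  shows "\<exists>p \<in> parabolic k. \<exists>j' \<in> {1..Suc (Suc k)}.
    descending (Suc k) j \<otimes> r i = p \<otimes> descending (Suc k) j'"
proof -
  have one: "\<one> \<in> parabolic k"
    using assms by (intro subgroup.one_closed[OF parabolic_subgroup]) auto
  consider "Suc i < j" | "Suc i = j" | "i = j" | "j < i" by linarith
  then show ?thesis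
  proof cases
    case 1
    then show ?thesis
      using assms by (intro bexI[of _ "r i"] bexI[of _ j] descending_commute r_in_parabolic) auto
  next
    case 2
    then show ?thesis
      using assms one descending_extend[of i "Suc k"]
      by (intro bexI[of _ \<one>] bexI[of _ i]) (auto simp del: descending.simps)
  next
    case 3
    then show ?thesis
      using assms one descending_shorten[of i "Suc k"]
      by (intro bexI[of _ \<one>] bexI[of _ "Suc i"]) (auto simp del: descending.simps)
  next
    case 4
    then obtain i' where "i = Suc i'" by (cases i) auto
    then show ?thesis
      using assms 4
      by (intro bexI[of _ "r i'"] bexI[of _ j])
        (auto simp del: descending.simps intro!: descending_shift r_in_parabolic)
  qed
qed

text \<open>
  By \<open>descending_absorb\<close> the set of all such products is stable under right multiplication by the
  generators, and it contains the identity.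
\<close>

lemma parabolic_factor:
  assumes k: "k < m" and x: "x \<in> parabolic (Suc k)"
  obtains p j where "p \<in> parabolic k" "j \<in> {1..Suc (Suc k)}" "x = p \<otimes> descending (Suc k) j"
proof -
  interpret P: subgroup "parabolic k" G using parabolic_subgroup k by simp
  define X where "X = {p \<otimes> descending (Suc k) j | p j. p \<in> parabolic k \<and> j \<in> {1..Suc (Suc k)}}"
  have X_carrier: "y \<in> carrier G" if "y \<in> X" for y
    using that k unfolding X_def by (auto simp del: descending.simps intro!: m_closed descending_closed)
  have step: "y \<otimes> r i \<in> X" if y: "y \<in> X" and i: "i \<in> {1..Suc k}" for y i
  proof -
    obtain p j where p: "p \<in> parabolic k" "j \<in> {1..Suc (Suc k)}" "y = p \<otimes> descending (Suc k) j"
      using y unfolding X_def by blast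
    obtain q j' where q: "q \<in> parabolic k" "j' \<in> {1..Suc (Suc k)}"
      "descending (Suc k) j \<otimes> r i = q \<otimes> descending (Suc k) j'"
      using descending_absorb[OF k p(2) i] by blast
    have c: "descending (Suc k) j \<in> carrier G" "descending (Suc k) j' \<in> carrier G" "r i \<in> carrier G"
      using k i by (simp_all del: descending.simps)
    have "y \<otimes> r i = p \<otimes> (descending (Suc k) j \<otimes> r i)"
      using p c by (simp add: m_assoc del: descending.simps)
    also have "\<dots> = (p \<otimes> q) \<otimes> descending (Suc k) j'"
      using p q c by (simp add: m_assoc del: descending.simps)
    finally show ?thesis unfolding X_def using p q by blast
  qed
  have "x \<in> carrier G \<and> (\<forall>y \<in> X. y \<otimes> x \<in> X)"
    using x unfolding parabolic_def[of "Suc k"]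
  proof (induction rule: generate.induct)
    case one
    then show ?case using X_carrier by simp
  next
    case (incl h)
    then obtain i where "i \<in> {1..Suc k}" "h = r i" by blast
    then show ?case using step k by simp
  next
    case (inv h)
    then obtain i where "i \<in> {1..Suc k}" "h = r i" by blast
    then show ?case using step k by (simp add: r_inverse)
  next
    case (eng h1 h2)
    then show ?case using X_carrier by (simp add: m_assoc[symmetric])
  qed
  moreover have "\<one> \<in> X"
  proof -
    have "\<one> = \<one> \<otimes> descending (Suc k) (Suc (Suc k))" by (simp add: descending_empty)
    then show ?thesis unfolding X_def using P.one_closed by fastforce
  qed
  ultimately have "x \<in> X" by (metis l_one)
  then show ?thesis using that unfolding X_def by blast
qed

end

locale type_A_permutations = type_A_coxeter +
  fixes h
  assumes h_hom: "h \<in> hom G (sym_group (Suc m))"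
    and h_r: "i \<in> {1..m} \<Longrightarrow> h (r i) = transpose i (Suc i)"
begin

lemma h_mult: "x \<in> carrier G \<Longrightarrow> y \<in> carrier G \<Longrightarrow> h (x \<otimes> y) = h x \<circ> h y"
  using hom_mult[OF h_hom] by (simp add: sym_group_mult)

lemma h_one: "h \<one> = id"
  using hom_one[OF h_hom] by (simp add: sym_group_one sym_group_is_group)

lemma h_parabolic: 
  assumes "k \<le> m" "x \<in> parabolic k" 
  shows "h x permutes {1..Suc k}"
  using assms(2) unfolding parabolic_def
proof (induction rule: generate.induct)
  case one
  show ?case using permutes_id by (metis h_one)
next
  case (incl x)
  then show ?case using assms(1) by (auto simp: h_r intro!: permutes_swap_id)
next
  case (inv x)
  then show ?case using assms(1) by (auto simp: h_r r_inverse intro!: permutes_swap_id)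
next
  case (eng x y)
  then have "x \<in> parabolic k" "y \<in> parabolic k" by (simp_all add: parabolic_def)
  then have "x \<in> carrier G" "y \<in> carrier G"
    using subgroup.subset[OF parabolic_subgroup[OF assms(1)]] by auto
  then show ?case using eng permutes_compose[of "h y" _ "h x"] by (simp only: h_mult)
qed

lemma h_descending: "k \<le> m \<Longrightarrow> 1 \<le> j \<Longrightarrow> j \<le> Suc k \<Longrightarrow> h (descending k j) j = Suc k"
proof (induction k)
  case 0
  then show ?case by (simp add: h_one)
next
  case (Suc k)
  show ?case
  proof (cases "j \<le> Suc k")
    case True
    then show ?thesis using Suc by (simp add: h_mult h_r)
  next
    case False
    then show ?thesis using Suc.prems by (simp add: h_one)
  qed
qed

text \<open>
  If \<open>x = p (r\<^sub>k\<^sub>+\<^sub>1 \<dots> r\<^sub>j)\<close> acts trivially, then \<open>j\<close>, which the second factor sends to \<open>k + 2\<close> and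
  which \<open>p\<close> leaves there, must equal \<open>k + 2\<close>. The second factor is then empty, so \<open>x = p\<close> lies in
  the smaller subgroup.
\<close>

lemma parabolic_faithful:
  "k \<le> m \<Longrightarrow> x \<in> parabolic k \<Longrightarrow> h x = id \<Longrightarrow> x = \<one>"
proof (induction k arbitrary: x)
  case 0
  then show ?case by (simp add: parabolic_def generate_empty)
next
  case (Suc k)
  obtain p j where p: "p \<in> parabolic k" "j \<in> {1..Suc (Suc k)}" "x = p \<otimes> descending (Suc k) j"
    using parabolic_factor[of k x] Suc.prems by auto
  have pc: "p \<in> carrier G"
    using p(1) subgroup.subset[OF parabolic_subgroup[of k]] Suc.prems by auto
  have "j = h x j" using Suc.prems by simp
  also have "\<dots> = h p (Suc (Suc k))"
    using p pc Suc.prems h_descending[of "Suc k" j] by (simp add: h_mult del: descending.simps)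
  also have "\<dots> = Suc (Suc k)"
    using h_parabolic[of k p] p(1) Suc.prems by (intro permutes_not_in) auto
  finally have "x = p" using p pc by (simp add: descending_empty)
  with Suc.IH[of p] p(1) Suc.prems show ?case by simp
qed

text \<open>
  The descending word indexed by the preimage of the last point under \<open>q\<close> carries that preimage to
  the last point, so \<open>q\<close> composed with the inverse of this word fixes the last point.
\<close>

lemma parabolic_full:
  "k \<le> m \<Longrightarrow> q permutes {1..Suc k} \<Longrightarrow> \<exists>x \<in> parabolic k. h x = q"
proof (induction k arbitrary: q)
  case 0
  then have "q = id" by (simp add: permutes_sing)
  moreover have "\<one> \<in> parabolic 0" by (simp add: parabolic_def generate.one)
  ultimately show ?case using h_one by blast
next
  case (Suc k)
  define j where "j = inv' q (Suc (Suc k))"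
  have qj: "q j = Suc (Suc k)"
    unfolding j_def by (rule permutes_inverses(1)[OF Suc.prems(2)])
  have j: "j \<in> {1..Suc (Suc k)}"
    unfolding j_def permutes_in_image[OF permutes_inv[OF Suc.prems(2)]] by simp
  let ?d = "descending (Suc k) j"
  have d: "?d \<in> parabolic (Suc k)" "?d \<in> carrier G"
    using descending_in_parabolic[of "Suc k" j] Suc.prems j by (simp_all del: descending.simps)
  have hd: "h ?d permutes {1..Suc (Suc k)}" using h_parabolic d Suc.prems by blast
  have hdj: "h ?d j = Suc (Suc k)" using h_descending[of "Suc k" j] Suc.prems j by (simp del: descending.simps)
  define q' where "q' = q \<circ> inv' (h ?d)"
  have q'_perm: "q' permutes {1..Suc (Suc k)}"
    unfolding q'_def using permutes_compose[OF permutes_inv[OF hd] Suc.prems(2)] .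
  have q'_fix: "q' (Suc (Suc k)) = Suc (Suc k)"
    unfolding q'_def using qj permutes_inverses(2)[OF hd, of j] by (simp add: hdj del: descending.simps)
  have q'_fix': "q' x = x" if "x \<in> {1..Suc (Suc k)} - {1..Suc k}" for x
  proof -
    have "x = Suc (Suc k)" using that by auto
    with q'_fix show ?thesis by simp
  qed
  have "q' permutes {1..Suc k}"
    using permutes_superset[OF q'_perm q'_fix'] by blast
  then obtain x where x: "x \<in> parabolic k" "h x = q'" using Suc.IH[of q'] Suc.prems(1) by auto
  then have x': "x \<in> parabolic (Suc k)" using parabolic_mono[of k "Suc k"] by auto
  have "x \<in> carrier G" using x' subgroup.subset[OF parabolic_subgroup] Suc.prems by auto
  then have "h (x \<otimes> ?d) = q"
    using x d permutes_inv_o(2)[OF hd]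
    by (simp add: h_mult q'_def comp_assoc del: descending.simps)
  moreover have "x \<otimes> ?d \<in> parabolic (Suc k)"
    using x' d(1) by (rule subgroup.m_closed[OF parabolic_subgroup[OF Suc.prems(1)]])
  ultimately show ?case by blast
qed

lemma coxeter_symmetric_iso: "h \<in> iso (G\<lparr>carrier := parabolic m\<rparr>) (sym_group (Suc m))"
proof -
  let ?P = "G\<lparr>carrier := parabolic m\<rparr>"
  have P: "subgroup (parabolic m) G" by (simp add: parabolic_subgroup)
  have onto: "h ` carrier ?P = carrier (sym_group (Suc m))"
  proof (intro equalityI subsetI)
    fix q assume "q \<in> h ` carrier ?P"
    then show "q \<in> carrier (sym_group (Suc m))"
      using h_parabolic[of m] unfolding sym_group_carrier by auto
  next
    fix q assume "q \<in> carrier (sym_group (Suc m))"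
    then show "q \<in> h ` carrier ?P"
      using parabolic_full[of m q] unfolding sym_group_carrier by auto
  qed
  interpret hP: group_hom ?P "sym_group (Suc m)" h
  proof (intro group_hom.intro group_hom_axioms.intro sym_group_is_group)
    show "group ?P" using P by (rule subgroup_imp_group)
    show "h \<in> hom ?P (sym_group (Suc m))"
      using h_hom subgroup.subset[OF P] by (auto simp: hom_def)
  qed
  show ?thesis
    unfolding hP.iso_iff
    using onto parabolic_faithful[of m] by (auto simp: sym_group_one)
qed

end

section \<open>Affine permutations of the residues modulo n\<close>

text \<open>
  The map \<open>i \<mapsto> a i + b\<close> on the representatives \<open>1, \<dots>, n\<close> of the residues modulo \<open>n\<close>; the shift by
  one moves the standard representatives \<open>0, \<dots>, n - 1\<close> to the points on which \<open>S\<^sub>n\<close> acts.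
\<close>

definition affine_perm :: "nat \<Rightarrow> int \<Rightarrow> int \<Rightarrow> nat \<Rightarrow> nat"
  where "affine_perm n a b i =
    (if i \<in> {1..n} then nat ((a * int i + b - 1) mod int n) + 1 else i)"

lemma affine_perm_in: "i \<in> {1..n} \<Longrightarrow> affine_perm n a b i \<in> {1..n}"
proof -
  assume i: "i \<in> {1..n}"
  then have "(a * int i + b - 1) mod int n < int n" by (intro pos_mod_bound) auto
  then show ?thesis using i by (auto simp: affine_perm_def nat_less_iff Suc_le_eq)
qed

lemma affine_perm_cong: "i \<in> {1..n} \<Longrightarrow> [int (affine_perm n a b i) = a * int i + b] (mod int n)"
proof -
  assume i: "i \<in> {1..n}"
  then have "0 \<le> (a * int i + b - 1) mod int n" by (intro pos_mod_sign) auto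
  then have "int (affine_perm n a b i) = (a * int i + b - 1) mod int n + 1"
    using i by (auto simp: affine_perm_def)
  then show ?thesis by (simp add: cong_def mod_simps)
qed

lemma cong_int_unique_residue:
  assumes "x \<in> {1..n}" "y \<in> {1..n}" "[int x = int y] (mod int n)"
  shows "x = y"
proof -
  have "[int x - 1 = int y - 1] (mod int n)" using assms(3) by (intro cong_diff) auto
  then have "(int x - 1) mod int n = (int y - 1) mod int n" by (simp add: cong_def)
  then show ?thesis using assms(1,2) by (simp add: mod_pos_pos_trivial)
qed

lemma affine_perm_eqI:
  assumes "\<And>i. i \<in> {1..n} \<Longrightarrow> f i \<in> {1..n}"
    and "\<And>i. i \<in> {1..n} \<Longrightarrow> [int (f i) = a * int i + b] (mod int n)"
    and "\<And>i. i \<notin> {1..n} \<Longrightarrow> f i = i"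
  shows "f = affine_perm n a b"
proof
  fix i
  show "f i = affine_perm n a b i"
  proof (cases "i \<in> {1..n}")
    case True
    show ?thesis
      using assms(1)[OF True] affine_perm_in[OF True]
        cong_trans[OF assms(2)[OF True] cong_sym[OF affine_perm_cong[OF True]]]
      by (rule cong_int_unique_residue)
  next
    case False
    then show ?thesis using assms(3)[OF False] by (simp only: affine_perm_def if_False)
  qed
qed

lemma affine_perm_compose:
  "affine_perm n a b \<circ> affine_perm n a' b' = affine_perm n (a * a') (a * b' + b)"
proof (rule affine_perm_eqI)
  fix i assume i: "i \<in> {1..n}"
  let ?j = "affine_perm n a' b' i"
  have j: "?j \<in> {1..n}" using i by (rule affine_perm_in)
  show "(affine_perm n a b \<circ> affine_perm n a' b') i \<in> {1..n}"
    unfolding comp_apply using j by (rule affine_perm_in)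
  have "[a * int ?j + b = a * (a' * int i + b') + b] (mod int n)"
    using affine_perm_cong[OF i] by (intro cong_add cong_mult cong_refl)
  with affine_perm_cong[OF j]
  have "[int (affine_perm n a b ?j) = a * (a' * int i + b') + b] (mod int n)"
    by (rule cong_trans)
  then show "[int ((affine_perm n a b \<circ> affine_perm n a' b') i) = a * a' * int i + (a * b' + b)] (mod int n)"
    by (simp add: algebra_simps)
qed (auto simp: affine_perm_def)

lemma affine_perm_id: "affine_perm n 1 0 = id"
  by (rule affine_perm_eqI[symmetric]) auto

lemma affine_perm_permutes:
  assumes "coprime a (int n)"
  shows "affine_perm n a b permutes {1..n}"
proof (rule bij_imp_permutes)
  have "inj_on (affine_perm n a b) {1..n}"
  proof (rule inj_onI)
    fix x y assume xy: "x \<in> {1..n}" "y \<in> {1..n}" "affine_perm n a b x = affine_perm n a b y"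
    then have "[a * int x + b = a * int y + b] (mod int n)"
      using affine_perm_cong[of x n a b] affine_perm_cong[of y n a b]
      by (metis cong_sym cong_trans)
    then have "[int x = int y] (mod int n)"
      using assms by (simp add: cong_add_rcancel cong_mult_lcancel)
    then show "x = y" using xy cong_int_unique_residue by blast
  qed
  moreover have "affine_perm n a b ` {1..n} \<subseteq> {1..n}" using affine_perm_in by blast
  ultimately show "bij_betw (affine_perm n a b) {1..n} {1..n}"
    by (simp add: bij_betw_def endo_inj_surj)
qed (auto simp: affine_perm_def)

lemma translation_closed: "affine_perm n 1 b \<in> carrier (sym_group n)"
  using affine_perm_permutes[of 1 n b] by (simp add: sym_group_carrier)

lemma translation_pow:
  "affine_perm n 1 1 [^]\<^bsub>sym_group n\<^esub> (j :: nat) = affine_perm n 1 (int j)"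
proof (induction j)
  case 0
  show ?case by (simp add: sym_group_one affine_perm_id)
next
  case (Suc j)
  then show ?case by (simp add: sym_group_mult affine_perm_compose add.commute)
qed

lemma translation_ord:
  assumes "n \<ge> 1"
  shows "group.ord (sym_group n) (affine_perm n 1 1) = n"
proof -
  interpret S: group "sym_group n" by (rule sym_group_is_group)
  have "affine_perm n 1 (int j) = id \<longleftrightarrow> n dvd j" for j
  proof
    assume "affine_perm n 1 (int j) = id"
    then have "[1 = 1 + int j] (mod int n)"
      using affine_perm_cong[of 1 n 1 "int j"] assms by simp
    then show "n dvd j" by (simp add: cong_iff_dvd_diff)
  next
    assume "n dvd j"
    then show "affine_perm n 1 (int j) = id"
      by (intro affine_perm_eqI[symmetric]) (auto simp: cong_iff_dvd_diff)
  qed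
  then show ?thesis
    by (simp add: S.ord_unique translation_closed translation_pow sym_group_one)
qed


section \<open>Virtual braid groups\<close>

lemma pres_class_eqI:
  assumes "(l, r) \<in> R" "l \<in> words S" "r \<in> words S"
  shows "pres_rel S R `` {l} = pres_rel S R `` {r}"
  using equiv_class_eq[OF equiv_pres_rel pres_rel.rel[OF assms(1), of "[]" "[]"]] assms by simp

text \<open>
  The exponent sum of the \<open>\<sigma>\<^sub>i\<close>. It is well defined because each relation of \<open>VB\<^sub>n\<close> has the same
  number of letters \<open>\<sigma>\<^sub>i\<close> on both sides.
\<close>

definition VB_degree :: "nat \<Rightarrow> vb_gen word set \<Rightarrow> int"
  where "VB_degree n = pres_lift integer_group (\<lambda>x. case x of Sig _ \<Rightarrow> 1 | Rho _ \<Rightarrow> 0)"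

lemma vb_degree_rels:
  "(l, r) \<in> vb_rels n \<Longrightarrow>
    word_eval integer_group (\<lambda>x. case x of Sig _ \<Rightarrow> 1 | Rho _ \<Rightarrow> 0) l =
    word_eval integer_group (\<lambda>x. case x of Sig _ \<Rightarrow> 1 | Rho _ \<Rightarrow> 0) r"
  by (auto simp: vb_rels_def)

lemma group_hom_VB_degree: "group_hom (VB n) integer_group (VB_degree n)"
  unfolding VB_degree_def VB_def
  by (intro group_hom.intro group_hom_axioms.intro group_presented_group group_integer_group
      group.pres_lift_hom vb_degree_rels) auto

lemma VB_degree_gen:
  assumes "i \<in> {1..n - 1}"
  shows "VB_degree n (pres_gen (vb_gens n) (vb_rels n) (Sig i)) = 1"
    and "VB_degree n (pres_gen (vb_gens n) (vb_rels n) (Rho i)) = 0"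
  using assms group.pres_lift_gen[OF group_integer_group _ vb_degree_rels]
  by (simp_all add: VB_degree_def vb_gens_def)

lemma pres_gen_VB_closed: "x \<in> vb_gens n \<Longrightarrow> pres_gen (vb_gens n) (vb_rels n) x \<in> carrier (VB n)"
  by (simp add: VB_def pres_gen_def presented_group_carrier)

lemma VB_type_A_permutations:
  assumes "n \<ge> 1"
  shows "type_A_permutations (VB n) (\<lambda>i. pres_gen (vb_gens n) (vb_rels n) (Rho i)) (n - 1) (VB_proj n)"
proof -
  have gen: "[(Rho i, True)] \<in> words (vb_gens n)" if "i \<in> {1..n - 1}" for i
    using that by (simp add: vb_gens_def)
  have one: "\<one>\<^bsub>VB n\<^esub> = pres_rel (vb_gens n) (vb_rels n) `` {[]}"
    by (simp add: VB_def presented_group_def)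
  interpret group "VB n" by (rule group_VB)
  show ?thesis
  proof unfold_locales
    fix i assume "i \<in> {1..n - 1}"
    then show "pres_gen (vb_gens n) (vb_rels n) (Rho i) \<in> carrier (VB n)"
      by (intro pres_gen_VB_closed) (simp add: vb_gens_def)
  next
    fix i assume i: "i \<in> {1..n - 1}"
    show "pres_gen (vb_gens n) (vb_rels n) (Rho i) \<otimes>\<^bsub>VB n\<^esub> pres_gen (vb_gens n) (vb_rels n) (Rho i)
        = \<one>\<^bsub>VB n\<^esub>"
      unfolding one unfolding VB_def pres_gen_def
      using gen[OF i] i
      by (simp add: presented_group_mult del: words_Cons) (rule pres_class_eqI; auto simp: vb_rels_def vb_gens_def)
  next
    fix i assume i: "1 \<le> i" "i < n - 1"
    then have g: "[(Rho i, True)] \<in> words (vb_gens n)" "[(Rho (Suc i), True)] \<in> words (vb_gens n)"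
      by (simp_all add: vb_gens_def)
    let ?r = "\<lambda>i. pres_gen (vb_gens n) (vb_rels n) (Rho i)"
    show "?r i \<otimes>\<^bsub>VB n\<^esub> ?r (Suc i) \<otimes>\<^bsub>VB n\<^esub> ?r i = ?r (Suc i) \<otimes>\<^bsub>VB n\<^esub> ?r i \<otimes>\<^bsub>VB n\<^esub> ?r (Suc i)"
      unfolding VB_def pres_gen_def
      using g i
      by (simp add: presented_group_mult) (rule pres_class_eqI; auto simp: vb_rels_def vb_gens_def)
  next
    fix i j assume i: "1 \<le> i" "Suc i < j" "j \<le> n - 1"
    then have g: "[(Rho i, True)] \<in> words (vb_gens n)" "[(Rho j, True)] \<in> words (vb_gens n)"
      by (simp_all add: vb_gens_def)
    let ?r = "\<lambda>i. pres_gen (vb_gens n) (vb_rels n) (Rho i)"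
    show "?r i \<otimes>\<^bsub>VB n\<^esub> ?r j = ?r j \<otimes>\<^bsub>VB n\<^esub> ?r i"
      unfolding VB_def pres_gen_def
      using g i
      by (simp add: presented_group_mult) (rule pres_class_eqI; auto simp: vb_rels_def vb_gens_def)
  next
    show "VB_proj n \<in> hom (VB n) (sym_group (Suc (n - 1)))"
      using VB_proj_hom[of n] assms by simp
  next
    fix i assume "i \<in> {1..n - 1}"
    then show "VB_proj n (pres_gen (vb_gens n) (vb_rels n) (Rho i)) = transpose i (Suc i)"
      using VB_proj_gen(2)[of i n] by simp
  qed
qed

text \<open>
  The translation by 1 and the multiplication by \<open>k\<close> are lifted to the copy of \<open>S\<^sub>n\<close> generated by
  the \<open>\<rho>\<^sub>i\<close>, where every relation between permutations holds for the lifts and the degree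
  vanishes. The pure element of nonzero degree is \<open>\<sigma>\<^sub>1 \<rho>\<^sub>1\<close>.
\<close>

lemma VB_realizes_Zn_semidirect_Z:
  assumes n: "n \<ge> 2" and k: "gcd n k = 1"
  shows "\<exists>H. subgroup H (VB n Mod derived (VB n) (VP n)) \<and>
    (VB n Mod derived (VB n) (VP n))\<lparr>carrier := H\<rparr> \<cong> Zn_semidirect_Z n k"
proof -
  let ?G = "VB n"
  let ?r = "\<lambda>i. pres_gen (vb_gens n) (vb_rels n) (Rho i)"
  interpret type_A_permutations ?G ?r "n - 1" "VB_proj n"
    using n by (intro VB_type_A_permutations) simp
  interpret \<pi>: group_hom ?G "sym_group n" "VB_proj n"
    by (intro group_hom.intro group_hom_axioms.intro group_VB sym_group_is_group VB_proj_hom)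
  interpret d: group_hom ?G integer_group "VB_degree n" by (rule group_hom_VB_degree)
  let ?P = "parabolic (n - 1)"
  have P: "subgroup ?P ?G" by (rule parabolic_subgroup) simp
  have Pc: "x \<in> carrier ?G" if "x \<in> ?P" for x using that subgroup.subset[OF P] by auto
  have inj: "x = y" if "x \<in> ?P" "y \<in> ?P" "VB_proj n x = VB_proj n y" for x y
    using coxeter_symmetric_iso that by (auto simp: iso_def bij_betw_def inj_on_def)
  have surj: "\<exists>x \<in> ?P. VB_proj n x = p" if "p permutes {1..n}" for p
    using parabolic_full[of "n - 1" p] that n by simp
  have d0: "VB_degree n x = 0" if "x \<in> ?P" for x
  proof -
    have "?P \<subseteq> kernel ?G integer_group (VB_degree n)"
      unfolding parabolic_def
      by (rule generate_subgroup_incl[OF _ d.subgroup_kernel])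
        (auto simp: kernel_def VB_degree_gen)
    then show ?thesis using that by (auto simp: kernel_def)
  qed
  obtain c where c: "c \<in> ?P" "VB_proj n c = affine_perm n 1 1"
    using surj[of "affine_perm n 1 1"] affine_perm_permutes[of 1 n 1] by auto
  obtain \<theta> where \<theta>: "\<theta> \<in> ?P" "VB_proj n \<theta> = affine_perm n (int k) 0"
    using surj[of "affine_perm n (int k) 0"] affine_perm_permutes[of "int k" n 0] k
    by (auto simp: coprime_iff_gcd_eq_1 gcd.commute)
  have c_pow: "c [^]\<^bsub>?G\<^esub> j \<in> ?P" for j :: nat
    using c(1) P by (induction j) (auto intro: subgroup.one_closed subgroup.m_closed)
  have proj_c_pow: "VB_proj n (c [^]\<^bsub>?G\<^esub> j) = affine_perm n 1 (int j)" for j :: nat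
    using c Pc by (simp add: \<pi>.hom_nat_pow translation_pow)
  have "affine_perm n 1 (int n) = id"
    using translation_ord[of n] \<pi>.H.pow_ord_eq_1[OF translation_closed, of 1] n
    by (simp add: translation_pow sym_group_one)
  then have c_n: "c [^]\<^bsub>?G\<^esub> n = \<one>\<^bsub>?G\<^esub>"
    using parabolic_faithful[OF _ c_pow] proj_c_pow[of n] by simp
  have rel: "\<theta> \<otimes>\<^bsub>?G\<^esub> c = c [^]\<^bsub>?G\<^esub> k \<otimes>\<^bsub>?G\<^esub> \<theta>"
  proof (rule inj)
    show "VB_proj n (\<theta> \<otimes>\<^bsub>?G\<^esub> c) = VB_proj n (c [^]\<^bsub>?G\<^esub> k \<otimes>\<^bsub>?G\<^esub> \<theta>)"
      using c \<theta> Pc c_pow by (simp add: h_mult proj_c_pow affine_perm_compose sym_group_mult)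
  qed (use c \<theta> c_pow P in \<open>auto intro: subgroup.m_closed\<close>)
  let ?s = "pres_gen (vb_gens n) (vb_rels n) (Sig 1)"
  have s: "?s \<in> carrier ?G" "?r 1 \<in> carrier ?G"
    using n by (intro pres_gen_VB_closed; simp add: vb_gens_def)+
  have one: "1 \<in> {1..n - 1}" using n by simp
  have l: "?s \<otimes>\<^bsub>?G\<^esub> ?r 1 \<in> kernel ?G (sym_group n) (VB_proj n)"
    using s VB_proj_gen[OF one] by (simp add: kernel_def h_mult sym_group_one sym_group_mult)
  have dl: "VB_degree n (?s \<otimes>\<^bsub>?G\<^esub> ?r 1) \<noteq> 0"
    using s VB_degree_gen[OF one] by simp
  show ?thesis
    unfolding VP_def
    by (rule Zn_semidirect_Z_mod_derived_kernel[OF \<pi>.group_hom_axioms d.group_hom_axioms _ k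
          _ c_n _ _ _ rel _ l dl])
      (use n c \<theta> Pc d0 translation_ord in auto)
qed

theorem theorem3p11:
  fixes n :: nat
  assumes "n \<ge> 2"
  shows "\<forall>k \<in> {1..n - 1}. gcd n k = 1 \<longrightarrow>
    virtually_cyclic (Zn_semidirect_Z n k) \<and>
    (\<exists>H. subgroup H (VB n Mod derived (VB n) (VP n)) \<and>
      (VB n Mod derived (VB n) (VP n))\<lparr>carrier := H\<rparr> \<cong> Zn_semidirect_Z n k)"
  using assms by (auto intro!: virtually_cyclic_Zn_semidirect_Z VB_realizes_Zn_semidirect_Z)

end
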